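(* Let (Path-Cov) be the mixed-integer program defined in the context. The following are valid inequalities for (Path-Cov), i.e. they are satisfied by every feasible solution of (Path-Cov): $$z_{ij}+z_{ji}\le\sum_{k\in W,\,k\ne i}y_{ik}+x_i\,\mathcal I_W(i)+\sum_{k\in V\setminus W,\,k\ne j}y_{jk}+x_j\big(1-\mathcal I_W(j)\big),\qquad [i,j]\in E,\ W\subseteq V,$$ where $\mathcal I_W$ is the indicator function of $W$, i.e. $\mathcal I_W(i)=1$ if $i\in W$ and $0$ otherwise.
   Context: Setting. $N=(V,E,\ell)$ is an undirected network with $V=\{1,\dots,n\}$; each edge $e=[k,q]=[q,k]\in E$ is an unordered pair of distinct nodes with length $\ell_e>0$, maximal length reduction $u_e\in[0,\ell_e)$ and unit reduction cost $c_e\ge 0$. Given are a coverage radius $R>0$, a budget $B\ge 0$, a number of facilities $p\in\mathbb N$, and demands $w_i\ge 0$, $i\in V$. Standing assumptions: $\ell_e-u_e\le R$ and $c_eu_e\le B$ for all $e\in E$. Write $a^+=\max\{a,0\}$. For a vector $\delta=(\delta_e)_{e\in E}$ of reductions, $d(i,j,\delta)$ is the shortest path length between $i$ and $j$ with respect to the edge lengths $\ell_e-\delta_e$; $d(i,j,\delta^{ij})$ denotes the minimum of $d(i,j,\delta)$ over all $\delta$ with $0\le\delta_e\le u_e$ ($e\in E$) and $\sum_{e\in E}c_e\delta_e\le B$ (if no path joins $i$ and $j$, this value is $+\infty$ and $y_{ij}$ is forced to be $0$, with $\infty\cdot 0=0$). (Path-Cov) has variables $x_j$ ($j\in V$), $y_{ij}$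 ($i,j\in V$, $i\ne j$), $z_{ij}$ and $z_{ji}$ for each $[i,j]\in E$, $d_i$ ($i\in V$), and $\delta_e=\delta_{[i,j]}$ ($e=[i,j]\in E$). Constraints indexed by $[i,j]\in E$ that are not symmetric in $i,j$ are imposed for both orderings $(i,j)$ and $(j,i)$. It reads: maximize $\sum_{i\in V}w_i\big(x_i+\sum_{j:[i,j]\in E}z_{ij}\big)$ subject to - $\sum_{j\in V}x_j=p$; - $y_{ij}\le x_j$ for $i,j\in V$, $i\ne j$; - $\sum_{e\in E}c_e\delta_e\le B$; - $\sum_{j:[i,j]\in E}z_{ij}+x_i\le 1$ for $i\in V$; - $\sum_{j:[i,j]\in E,\,j\ne k}z_{ij}+x_i\ge z_{ki}$ for $[k,i]\in E$; - $0\le d_i\le R\sum_{j:[i,j]\in E}z_{ij}$ for $i\in V$; - $d_i\ge\sum_{j\in V\setminus\{i\}}d(i,j,\delta^{ij})\,y_{ij}$ for $i\in V$; - $d_i\ge d_j+\ell_{[i,j]}z_{ij}-\delta_{[i,j]}-R(1-z_{ij})+z_{ji}(R-\ell_{[i,j]})^+$ for $[i,j]\in E$; - $0\le\delta_e\le u_e(z_{ij}+z_{ji})$ for $e=[i,j]\in E$; - $\sum_{k\in V\setminus\{i\}}y_{ik}=\sum_{j:[i,j]\in E}z_{ij}$ for $i\in V$; - $y_{ik}\ge z_{ij}+z_{ji}+y_{jk}-1$ for $[i,j]\in E$, $k\in V\setminus\{i,j\}$; - $y_{ij}\ge z_{ij}+z_{ji}+x_j-1$ for $[i,j]\in E$;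 - $x_j\in\{0,1\}$ for $j\in V$; $y_{ij}\in\{0,1\}$ for $i\ne j$; $z_{ij}\in\{0,1\}$ for $[i,j]\in E$. *)

theory Defs
  imports Complex_Main "HOL-Library.Extended_Real" "HOL-Library.Indicator_Function"
begin

(* An undirected edge [k,q] is the two-element set {k, q}; edge data are functions of that set,
   hence automatically symmetric. *)

record coverage_network =
  num_nodes :: nat
  edges :: "nat set set"
  len :: "nat set \<Rightarrow> real"
  max_red :: "nat set \<Rightarrow> real"
  red_cost :: "nat set \<Rightarrow> real"
  radius :: real
  budget :: real
  num_facilities :: nat
  demand :: "nat \<Rightarrow> real"

definition nodes :: "coverage_network \<Rightarrow> nat set" where
  "nodes N = {1..num_nodes N}"

definition is_coverage_network :: "coverage_network \<Rightarrow> bool" where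
  "is_coverage_network N \<longleftrightarrow>
     edges N \<subseteq> {e. e \<subseteq> nodes N \<and> card e = 2} \<and>
     (\<forall>e\<in>edges N. len N e > 0 \<and> 0 \<le> max_red N e \<and> max_red N e < len N e \<and> red_cost N e \<ge> 0) \<and>
     radius N > 0 \<and> budget N \<ge> 0 \<and>
     (\<forall>i\<in>nodes N. demand N i \<ge> 0) \<and>
     (\<forall>e\<in>edges N. len N e - max_red N e \<le> radius N \<and> red_cost N e * max_red N e \<le> budget N)"

definition nbrs :: "coverage_network \<Rightarrow> nat \<Rightarrow> nat set" where
  "nbrs N i = {j \<in> nodes N. {i, j} \<in> edges N}"

definition is_path :: "coverage_network \<Rightarrow> nat \<Rightarrow> nat \<Rightarrow> nat list \<Rightarrow> bool" where
  "is_path N i j vs \<longleftrightarrow>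
     vs \<noteq> [] \<and> hd vs = i \<and> last vs = j \<and> distinct vs \<and> set vs \<subseteq> nodes N \<and>
     successively (\<lambda>a b. {a, b} \<in> edges N) vs"

definition path_length :: "(nat set \<Rightarrow> real) \<Rightarrow> nat list \<Rightarrow> real" where
  "path_length lw vs = (\<Sum>k<length vs - 1. lw {vs ! k, vs ! Suc k})"

(* The infimum of the empty set in ereal is \<infinity>, the value required when no path joins i and j. *)
definition sp_dist :: "coverage_network \<Rightarrow> nat \<Rightarrow> nat \<Rightarrow> (nat set \<Rightarrow> real) \<Rightarrow> ereal" where
  "sp_dist N i j \<delta> =
     (INF vs\<in>{vs. is_path N i j vs}. ereal (path_length (\<lambda>e. len N e - \<delta> e) vs))"

definition reductions :: "coverage_network \<Rightarrow> (nat set \<Rightarrow> real) set" where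
  "reductions N =
     {\<delta>. (\<forall>e\<in>edges N. 0 \<le> \<delta> e \<and> \<delta> e \<le> max_red N e) \<and>
          (\<Sum>e\<in>edges N. red_cost N e * \<delta> e) \<le> budget N}"

(* The infimum is a minimum: there are finitely many simple paths, and the length of each one
   depends affinely on \<delta>, which ranges over a nonempty compact polytope in the coordinates
   indexed by the edges. *)
definition min_dist :: "coverage_network \<Rightarrow> nat \<Rightarrow> nat \<Rightarrow> ereal" where
  "min_dist N i j = (INF \<delta>\<in>reductions N. sp_dist N i j \<delta>)"

definition path_cov_objective ::
    "coverage_network \<Rightarrow> (nat \<Rightarrow> real) \<Rightarrow> (nat \<Rightarrow> nat \<Rightarrow> real) \<Rightarrow> real" where
  "path_cov_objective N x z = (\<Sum>i\<in>nodes N. demand N i * (x i + (\<Sum>j\<in>nbrs N i. z i j)))"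

(* A quantification over i and j with {i, j} \<in> edges N runs over both orderings of every edge.
   Values of the variables outside their index sets (such as y i i) are unconstrained and are
   never used.  The constraint involving min_dist lives in ereal, where \<infinity> * 0 = 0. *)
definition path_cov_feasible ::
    "coverage_network \<Rightarrow> (nat \<Rightarrow> real) \<Rightarrow> (nat \<Rightarrow> nat \<Rightarrow> real) \<Rightarrow> (nat \<Rightarrow> nat \<Rightarrow> real) \<Rightarrow>
     (nat \<Rightarrow> real) \<Rightarrow> (nat set \<Rightarrow> real) \<Rightarrow> bool" where
  "path_cov_feasible N x y z d \<delta> \<longleftrightarrow>
     (\<Sum>j\<in>nodes N. x j) = real (num_facilities N) \<and>
     (\<forall>i\<in>nodes N. \<forall>j\<in>nodes N. i \<noteq> j \<longrightarrow> y i j \<le> x j) \<and>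
     (\<Sum>e\<in>edges N. red_cost N e * \<delta> e) \<le> budget N \<and>
     (\<forall>i\<in>nodes N. (\<Sum>j\<in>nbrs N i. z i j) + x i \<le> 1) \<and>
     (\<forall>k i. {k, i} \<in> edges N \<longrightarrow> (\<Sum>j\<in>nbrs N i - {k}. z i j) + x i \<ge> z k i) \<and>
     (\<forall>i\<in>nodes N. 0 \<le> d i \<and> d i \<le> radius N * (\<Sum>j\<in>nbrs N i. z i j)) \<and>
     (\<forall>i\<in>nodes N. ereal (d i) \<ge> (\<Sum>j\<in>nodes N - {i}. min_dist N i j * ereal (y i j))) \<and>
     (\<forall>i j. {i, j} \<in> edges N \<longrightarrow>
        d i \<ge> d j + len N {i, j} * z i j - \<delta> {i, j} - radius N * (1 - z i j)
                + z j i * max (radius N - len N {i, j}) 0) \<and>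
     (\<forall>i j. {i, j} \<in> edges N \<longrightarrow>
        0 \<le> \<delta> {i, j} \<and> \<delta> {i, j} \<le> max_red N {i, j} * (z i j + z j i)) \<and>
     (\<forall>i\<in>nodes N. (\<Sum>k\<in>nodes N - {i}. y i k) = (\<Sum>j\<in>nbrs N i. z i j)) \<and>
     (\<forall>i j. {i, j} \<in> edges N \<longrightarrow>
        (\<forall>k\<in>nodes N - {i, j}. y i k \<ge> z i j + z j i + y j k - 1)) \<and>
     (\<forall>i j. {i, j} \<in> edges N \<longrightarrow> y i j \<ge> z i j + z j i + x j - 1) \<and>
     (\<forall>j\<in>nodes N. x j \<in> {0, 1}) \<and>
     (\<forall>i\<in>nodes N. \<forall>j\<in>nodes N. i \<noteq> j \<longrightarrow> y i j \<in> {0, 1}) \<and>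
     (\<forall>i j. {i, j} \<in> edges N \<longrightarrow> z i j \<in> {0, 1})"

end

theory Submission imports Defs begin

text \<open>
  Read \<open>y i k = 1\<close> as ``node \<open>i\<close> is assigned to the facility \<open>k\<close>'' and let a node that hosts
  a facility be assigned to itself, so that the assignment vector of \<open>i\<close> has the entry \<open>x i\<close>
  at \<open>k = i\<close>.  The right-hand side of the inequality then collects the entries in \<open>W\<close> of the
  assignment vector of \<open>i\<close> and the entries outside \<open>W\<close> of that of \<open>j\<close>.

  If the edge \<open>{i, j}\<close> is not used, the left-hand side is zero and there is nothing to show
  beyond nonnegativity.  If it is used in either direction, \<open>i\<close> and \<open>j\<close> lie on a common path to
  a facility, and the constraints propagating assignments along used edges make their
  assignment vectors equal (\<open>assignment_eq_of_used_edge\<close>).  The set \<open>W\<close> then merely splits one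
  vector into two parts, and the right-hand side is the total assignment of \<open>i\<close>.  This total is
  \<open>x i\<close> plus the number of chosen arcs leaving \<open>i\<close>, which bounds \<open>z i j + z j i\<close>: a path
  that enters \<open>i\<close> from \<open>j\<close> must end there or leave towards a node other than \<open>j\<close>
  (\<open>edge_use_le_total_assignment\<close>).
\<close>

definition assignment ::
    "(nat \<Rightarrow> real) \<Rightarrow> (nat \<Rightarrow> nat \<Rightarrow> real) \<Rightarrow> nat \<Rightarrow> nat \<Rightarrow> real" where
  "assignment x y i k = (if k = i then x i else y i k)"

lemma edge_endpoints:
  assumes "is_coverage_network N" and "{i, j} \<in> edges N"
  shows "i \<in> nodes N" "j \<in> nodes N" "i \<noteq> j"
proof -
  have "{i, j} \<subseteq> nodes N" "card {i, j} = 2"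
    using assms unfolding is_coverage_network_def by blast+
  then show "i \<in> nodes N" "j \<in> nodes N" "i \<noteq> j"
    by auto
qed

lemma finite_nodes: "finite (nodes N)"
  by (simp add: nodes_def)

lemma feasible_facility_bound:
  assumes "path_cov_feasible N x y z d \<delta>"
  shows "\<forall>i\<in>nodes N. \<forall>j\<in>nodes N. i \<noteq> j \<longrightarrow> y i j \<le> x j"
  using assms unfolding path_cov_feasible_def by (elim conjE)

lemma feasible_conservation:
  assumes "path_cov_feasible N x y z d \<delta>"
  shows "\<forall>k i. {k, i} \<in> edges N \<longrightarrow> (\<Sum>j\<in>nbrs N i - {k}. z i j) + x i \<ge> z k i"
  using assms unfolding path_cov_feasible_def by (elim conjE)

lemma feasible_assignment_total:
  assumes "path_cov_feasible N x y z d \<delta>"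
  shows "\<forall>i\<in>nodes N. (\<Sum>k\<in>nodes N - {i}. y i k) = (\<Sum>j\<in>nbrs N i. z i j)"
  using assms unfolding path_cov_feasible_def by (elim conjE)

lemma feasible_propagation:
  assumes "path_cov_feasible N x y z d \<delta>"
  shows "\<forall>i j. {i, j} \<in> edges N \<longrightarrow>
    (\<forall>k\<in>nodes N - {i, j}. y i k \<ge> z i j + z j i + y j k - 1)"
  using assms unfolding path_cov_feasible_def by (elim conjE)

lemma feasible_reach:
  assumes "path_cov_feasible N x y z d \<delta>"
  shows "\<forall>i j. {i, j} \<in> edges N \<longrightarrow> y i j \<ge> z i j + z j i + x j - 1"
  using assms unfolding path_cov_feasible_def by (elim conjE)

lemma feasible_binary:
  assumes "path_cov_feasible N x y z d \<delta>"
  shows "\<forall>j\<in>nodes N. x j \<in> {0, 1}"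
    and "\<forall>i\<in>nodes N. \<forall>j\<in>nodes N. i \<noteq> j \<longrightarrow> y i j \<in> {0, 1}"
    and "\<forall>i j. {i, j} \<in> edges N \<longrightarrow> z i j \<in> {0, 1}"
  using assms unfolding path_cov_feasible_def by - (elim conjE, assumption)+

lemma assignment_nonneg:
  assumes "path_cov_feasible N x y z d \<delta>" and "i \<in> nodes N" and "k \<in> nodes N"
  shows "0 \<le> assignment x y i k"
proof -
  have "x i \<in> {0, 1}" and "k \<noteq> i \<Longrightarrow> y i k \<in> {0, 1}"
    using feasible_binary(1,2)[OF assms(1)] assms(2,3) by auto
  then show ?thesis
    by (auto simp: assignment_def)
qed

lemma assignment_le_of_used_edge:
  assumes net: "is_coverage_network N"
    and feas: "path_cov_feasible N x y z d \<delta>"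
    and edge: "{i, j} \<in> edges N"
    and used: "1 \<le> z i j + z j i"
    and k: "k \<in> nodes N"
  shows "assignment x y j k \<le> assignment x y i k"
proof -
  note ends = edge_endpoints[OF net edge]
  have propagate: "k \<noteq> i \<Longrightarrow> k \<noteq> j \<Longrightarrow> y i k \<ge> z i j + z j i + y j k - 1"
    using feasible_propagation[OF feas] edge k by simp
  have reach: "y i j \<ge> z i j + z j i + x j - 1"
    using feasible_reach[OF feas] edge by simp
  have facility: "y j i \<le> x i"
    using feasible_facility_bound[OF feas] ends by simp
  consider "k = i" | "k = j" | "k \<noteq> i" "k \<noteq> j"
    by blast
  then show ?thesis
    using propagate reach facility used ends(3) by cases (auto simp: assignment_def)
qed

text \<open>Being used in one direction or the other is symmetric in the endpoints, so the
  propagation of assignments runs both ways along the edge.\<close>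

lemma assignment_eq_of_used_edge:
  assumes "is_coverage_network N"
    and "path_cov_feasible N x y z d \<delta>"
    and "{i, j} \<in> edges N"
    and "1 \<le> z i j + z j i"
    and "k \<in> nodes N"
  shows "assignment x y i k = assignment x y j k"
  using assignment_le_of_used_edge[OF assms]
    assignment_le_of_used_edge[of N x y z d \<delta> j i k] assms
  by (simp add: insert_commute add.commute)

lemma sum_assignment_split:
  assumes "finite A"
  shows "sum (assignment x y i) A = (\<Sum>k\<in>A - {i}. y i k) + x i * indicator A i"
proof -
  have "sum (assignment x y i) (A - {i}) = (\<Sum>k\<in>A - {i}. y i k)"
    by (rule sum.cong) (auto simp: assignment_def)
  then show ?thesis
    using assms by (cases "i \<in> A") (auto simp: sum.remove assignment_def)
qed

text \<open>The arc from \<open>i\<close> to \<open>j\<close> is one of the chosen arcs leaving \<open>i\<close>; path conservation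
  at \<open>i\<close> charges the arc from \<open>j\<close> to \<open>i\<close> to the remaining ones and to \<open>x i\<close>.\<close>

lemma edge_use_le_total_assignment:
  assumes net: "is_coverage_network N"
    and feas: "path_cov_feasible N x y z d \<delta>"
    and edge: "{i, j} \<in> edges N"
  shows "z i j + z j i \<le> sum (assignment x y i) (nodes N)"
proof -
  note ends = edge_endpoints[OF net edge]
  have "{j, i} \<in> edges N"
    using edge by (simp add: insert_commute)
  then have conservation: "z j i \<le> (\<Sum>q\<in>nbrs N i - {j}. z i q) + x i"
    using feasible_conservation[OF feas] by simp
  have nbr: "j \<in> nbrs N i" "finite (nbrs N i)"
    using edge ends finite_nodes by (auto simp: nbrs_def)
  have "z i j + z j i \<le> (\<Sum>q\<in>nbrs N i. z i q) + x i"
    using conservation by (simp add: sum.remove[OF nbr(2,1)])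
  also have "(\<Sum>q\<in>nbrs N i. z i q) = (\<Sum>k\<in>nodes N - {i}. y i k)"
    using feasible_assignment_total[OF feas] ends(1) by simp
  finally show ?thesis
    using ends(1) by (simp add: sum_assignment_split finite_nodes)
qed

theorem lemma3:
  fixes N :: coverage_network
    and x d :: "nat \<Rightarrow> real"
    and y z :: "nat \<Rightarrow> nat \<Rightarrow> real"
    and \<delta> :: "nat set \<Rightarrow> real"
    and i j :: nat
    and W :: "nat set"
  assumes "is_coverage_network N"
    and "path_cov_feasible N x y z d \<delta>"
    and "{i, j} \<in> edges N"
    and "W \<subseteq> nodes N"
  shows "z i j + z j i \<le>
           (\<Sum>k\<in>W - {i}. y i k) + x i * indicator W i
           + (\<Sum>k\<in>(nodes N - W) - {j}. y j k) + x j * (1 - indicator W j)"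
proof -
  note ends = edge_endpoints[OF assms(1,3)]
  have fin: "finite W" "finite (nodes N - W)"
    using assms(4) finite_nodes finite_subset by auto
  have complement: "indicator (nodes N - W) j = (1 - indicator W j :: real)"
    using ends(2) by (simp add: indicator_def)
  have "z i j + z j i \<le> sum (assignment x y i) W + sum (assignment x y j) (nodes N - W)"
  proof (cases "1 \<le> z i j + z j i")
    case True
    have "sum (assignment x y j) (nodes N - W) = sum (assignment x y i) (nodes N - W)"
      using assignment_eq_of_used_edge[OF assms(1-3) True] by (intro sum.cong) auto
    then show ?thesis
      using edge_use_le_total_assignment[OF assms(1-3)]
        sum.subset_diff[OF assms(4) finite_nodes, of "assignment x y i"]
      by simp
  next
    case False
    have "{j, i} \<in> edges N"
      using assms(3) by (simp add: insert_commute)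
    then have "z i j \<in> {0, 1}" "z j i \<in> {0, 1}"
      using feasible_binary(3)[OF assms(2)] assms(3) by simp_all
    \<comment> \<open>The variables are binary, so an edge that is not used contributes exactly zero.\<close>
    then have "z i j + z j i = 0"
      using False by auto
    moreover have "0 \<le> sum (assignment x y i) W" "0 \<le> sum (assignment x y j) (nodes N - W)"
      using assignment_nonneg[OF assms(2)] ends assms(4) by (auto intro!: sum_nonneg)
    ultimately show ?thesis
      by simp
  qed
  then show ?thesis
    by (simp add: sum_assignment_split fin complement)
qed

end
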